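(* For the Petersen graph $P$, $d_{\rm st}(P)=2$.
   Context: The Petersen graph is the cubic graph on $\{1,\dots,10\}$ with outer $5$-cycle $1\text{-}2\text{-}3\text{-}4\text{-}5\text{-}1$, spokes $1\text{-}6$, $2\text{-}7$, $3\text{-}8$, $4\text{-}9$, $5\text{-}10$, and inner pentagram $6\text{-}8\text{-}10\text{-}7\text{-}9\text{-}6$. For a finite simple graph $G=(V,E)$, a set $D\subseteq V$ is a strong dominating set if for every vertex $x\in V\setminus D$ there is a vertex $y\in D$ with $xy\in E$ and $\deg(x)\le \deg(y)$. A strong domatic partition of $G$ is a partition of $V(G)$ all of whose classes are strong dominating sets of $G$. The strong domatic number $d_{\rm st}(G)$ is the maximum number of classes of a strong domatic partition of $G$. *)

theory Defs
  imports Main "HOL-Library.Disjoint_Sets"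
begin

text \<open>A finite simple graph is given by its vertex set \<open>V\<close> and its edge set \<open>E\<close>, every edge
  being the two-element set of its ends.\<close>

definition finite_simple_graph :: "'a set \<Rightarrow> 'a set set \<Rightarrow> bool" where
  "finite_simple_graph V E \<longleftrightarrow> finite V \<and> (\<forall>e\<in>E. e \<subseteq> V \<and> card e = 2)"

definition degree :: "'a set set \<Rightarrow> 'a \<Rightarrow> nat" where
  "degree E x = card {e \<in> E. x \<in> e}"

definition strong_dominating_set :: "'a set \<Rightarrow> 'a set set \<Rightarrow> 'a set \<Rightarrow> bool" where
  "strong_dominating_set V E D \<longleftrightarrow>
     D \<subseteq> V \<and> (\<forall>x\<in>V - D. \<exists>y\<in>D. {x, y} \<in> E \<and> degree E x \<le> degree E y)"

definition strong_domatic_partition :: "'a set \<Rightarrow> 'a set set \<Rightarrow> 'a set set \<Rightarrow> bool" where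
  "strong_domatic_partition V E P \<longleftrightarrow>
     partition_on V P \<and> (\<forall>D\<in>P. strong_dominating_set V E D)"

definition strong_domatic_number :: "'a set \<Rightarrow> 'a set set \<Rightarrow> nat" where
  "strong_domatic_number V E = Max {card P |P. strong_domatic_partition V E P}"

text \<open>\<^const>\<open>Max\<close> is unspecified on infinite and on empty sets; the next two lemmas show that
  neither occurs for a finite graph.\<close>

lemma finite_strong_domatic_partition_cards:
  assumes "finite V"
  shows "finite {card P |P. strong_domatic_partition V E P}"
proof -
  have "{P. strong_domatic_partition V E P} \<subseteq> {P. partition_on V P}"
    by (auto simp: strong_domatic_partition_def)
  then have "finite {P. strong_domatic_partition V E P}"
    using finitely_many_partition_on[OF assms] finite_subset by blast
  then show ?thesis by simp
qed

lemma ex_strong_domatic_partition: "\<exists>P. strong_domatic_partition V E P"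
proof (cases "V = {}")
  case True
  then show ?thesis
    by (intro exI[of _ "{}"]) (simp add: strong_domatic_partition_def partition_on_empty)
next
  case False
  then show ?thesis
    by (intro exI[of _ "{V}"])
       (simp add: strong_domatic_partition_def strong_dominating_set_def partition_on_space)
qed

definition petersen_verts :: "nat set" where
  "petersen_verts = {1..10}"

definition petersen_edges :: "nat set set" where
  "petersen_edges =
     {{1, 2}, {2, 3}, {3, 4}, {4, 5}, {5, 1},
      {1, 6}, {2, 7}, {3, 8}, {4, 9}, {5, 10},
      {6, 8}, {8, 10}, {10, 7}, {7, 9}, {9, 6}}"

lemma finite_simple_graph_petersen: "finite_simple_graph petersen_verts petersen_edges"
  by (simp add: finite_simple_graph_def petersen_verts_def petersen_edges_def)

end

theory Submission
  imports Defs
begin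

text \<open>The two 5-cycles are joined by a perfect matching and the graph is regular, so each of them is
  strongly dominating. Conversely, three pairwise disjoint dominating sets would colour some of the
  vertices such that each of the ten closed neighbourhoods, of size four, sees all three colours;
  going through the colourings shows that this is impossible.\<close>

definition petersen_nbrs :: "nat \<Rightarrow> nat set" where
  "petersen_nbrs x = {y. {x, y} \<in> petersen_edges}"

lemma petersen_nbrs_simps:
  "petersen_nbrs 1 = {2, 5, 6}"
  "petersen_nbrs 2 = {1, 3, 7}"
  "petersen_nbrs 3 = {2, 4, 8}"
  "petersen_nbrs 4 = {3, 5, 9}"
  "petersen_nbrs 5 = {1, 4, 10}"
  "petersen_nbrs 6 = {1, 8, 9}"
  "petersen_nbrs 7 = {2, 9, 10}"
  "petersen_nbrs 8 = {3, 6, 10}"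
  "petersen_nbrs 9 = {4, 6, 7}"
  "petersen_nbrs 10 = {5, 7, 8}"
  by (auto simp: petersen_nbrs_def petersen_edges_def doubleton_eq_iff)

lemma petersen_verts_eq: "petersen_verts = {1, 2, 3, 4, 5, 6, 7, 8, 9, 10}"
  by (simp only: petersen_verts_def set_eq_iff atLeastAtMost_iff insert_iff empty_iff) presburger

text \<open>The map sending \<open>y\<close> to \<open>{x, y}\<close> is a bijection from the
  neighbours of \<open>x\<close> onto the edges at \<open>x\<close>, so the degree can be read off
  the neighbour table.\<close>

lemma degree_petersen: "x \<in> petersen_verts \<Longrightarrow> degree petersen_edges x = 3"
proof -
  assume x: "x \<in> petersen_verts"
  have "degree petersen_edges x = card ((\<lambda>y. {x, y}) ` petersen_nbrs x)"
  proof -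
    have "\<exists>y. e = {x, y}" if "e \<in> petersen_edges" "x \<in> e" for e
      using that by (fastforce simp: petersen_edges_def)
    then have "{e \<in> petersen_edges. x \<in> e} = (\<lambda>y. {x, y}) ` petersen_nbrs x"
      by (auto simp: petersen_nbrs_def)
    then show ?thesis by (simp add: degree_def)
  qed
  also have "\<dots> = card (petersen_nbrs x)"
    by (rule card_image) (auto simp: inj_on_def doubleton_eq_iff)
  also have "\<dots> = 3"
    \<comment> \<open>Without \<open>One_nat_def\<close> the numeral \<open>1\<close> is not
      rewritten to \<open>Suc 0\<close>, so the table entries still match.\<close>
    using x by (auto simp: petersen_verts_eq petersen_nbrs_simps simp del: One_nat_def)
  finally show ?thesis .
qed

text \<open>By 3-regularity the degree condition always holds on vertices, so strong domination
  reduces to ordinary domination.\<close>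

lemma strong_dominating_set_petersen_iff:
  "strong_dominating_set petersen_verts petersen_edges D \<longleftrightarrow>
     D \<subseteq> petersen_verts \<and> (\<forall>x\<in>petersen_verts. x \<in> D \<or> (\<exists>y\<in>petersen_nbrs x. y \<in> D))"
  unfolding strong_dominating_set_def petersen_nbrs_def
  using degree_petersen by (fastforce simp: subset_iff)

lemma petersen_no_three_disjoint_dominating_sets:
  assumes "strong_dominating_set petersen_verts petersen_edges A"
    and "strong_dominating_set petersen_verts petersen_edges B"
    and "strong_dominating_set petersen_verts petersen_edges C"
    and "A \<inter> B = {}" "A \<inter> C = {}" "B \<inter> C = {}"
  shows False
proof -
  \<comment> \<open>One clause per closed neighbourhood, spelled out so that every membership is a
    propositional atom.\<close>
  have dom: "(1 \<in> D \<or> 2 \<in> D \<or> 5 \<in> D \<or> 6 \<in> D) \<and> (2 \<in> D \<or> 1 \<in> D \<or> 3 \<in> D \<or> 7 \<in> D) \<and>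
      (3 \<in> D \<or> 2 \<in> D \<or> 4 \<in> D \<or> 8 \<in> D) \<and> (4 \<in> D \<or> 3 \<in> D \<or> 5 \<in> D \<or> 9 \<in> D) \<and>
      (5 \<in> D \<or> 1 \<in> D \<or> 4 \<in> D \<or> 10 \<in> D) \<and> (6 \<in> D \<or> 1 \<in> D \<or> 8 \<in> D \<or> 9 \<in> D) \<and>
      (7 \<in> D \<or> 2 \<in> D \<or> 9 \<in> D \<or> 10 \<in> D) \<and> (8 \<in> D \<or> 3 \<in> D \<or> 6 \<in> D \<or> 10 \<in> D) \<and>
      (9 \<in> D \<or> 4 \<in> D \<or> 6 \<in> D \<or> 7 \<in> D) \<and> (10 \<in> D \<or> 5 \<in> D \<or> 7 \<in> D \<or> 8 \<in> D)"
    if "strong_dominating_set petersen_verts petersen_edges D" for D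
    using that unfolding strong_dominating_set_petersen_iff unfolding petersen_verts_eq
    by (simp only: ball_simps bex_simps petersen_nbrs_simps) simp
  have disj: "x \<notin> A \<or> x \<notin> B" "x \<notin> A \<or> x \<notin> C" "x \<notin> B \<or> x \<notin> C" for x
    using assms(4-6) by auto
  show False
    \<comment> \<open>Thirty atoms remain, one for each vertex and set; the domination and
      disjointness clauses on them are jointly unsatisfiable.\<close>
    using dom[OF assms(1)] dom[OF assms(2)] dom[OF assms(3)]
      disj[of 1] disj[of 2] disj[of 3] disj[of 4] disj[of 5]
      disj[of 6] disj[of 7] disj[of 8] disj[of 9] disj[of 10]
    by sat
qed

text \<open>Any three classes of a larger partition would be disjoint dominating sets; they need not
  cover all vertices.\<close>

lemma strong_domatic_partition_petersen_card_le:
  assumes "strong_domatic_partition petersen_verts petersen_edges P"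
  shows "card P \<le> 2"
proof (rule ccontr)
  assume "\<not> card P \<le> 2"
  then obtain Q where "Q \<subseteq> P" "card Q = 3"
    by (metis not_less_eq_eq numeral_2_eq_2 numeral_3_eq_3 obtain_subset_with_card_n)
  then obtain A B C where ABC: "A \<in> P" "B \<in> P" "C \<in> P" "A \<noteq> B" "A \<noteq> C" "B \<noteq> C"
    by (auto simp: card_3_iff)
  have "disjoint P"
    using assms by (simp add: strong_domatic_partition_def partition_on_def)
  then have "A \<inter> B = {}" "A \<inter> C = {}" "B \<inter> C = {}"
    using ABC by (auto simp: disjoint_def)
  then show False
    using petersen_no_three_disjoint_dominating_sets[of A B C] ABC assms
    by (simp add: strong_domatic_partition_def)
qed

text \<open>Witness for the lower bound: the classes are the outer cycle and the inner pentagram,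
  and each spoke leads from one to the other.\<close>

lemma strong_domatic_partition_petersen:
  "strong_domatic_partition petersen_verts petersen_edges {{1, 2, 3, 4, 5}, {6, 7, 8, 9, 10}}"
  unfolding strong_domatic_partition_def
proof
  show "partition_on petersen_verts {{1, 2, 3, 4, 5}, {6, 7, 8, 9, 10}}"
    by (auto simp: partition_on_def disjoint_def petersen_verts_eq)
  show "\<forall>D\<in>{{1, 2, 3, 4, 5}, {6, 7, 8, 9, 10}}.
      strong_dominating_set petersen_verts petersen_edges D"
    unfolding strong_dominating_set_petersen_iff unfolding petersen_verts_eq
    by (simp only: ball_simps bex_simps petersen_nbrs_simps) simp
qed

theorem theorem3p3:
  shows "strong_domatic_number petersen_verts petersen_edges = 2"
  unfolding strong_domatic_number_def
proof (rule Max_eqI)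
  show "finite {card P |P. strong_domatic_partition petersen_verts petersen_edges P}"
    by (rule finite_strong_domatic_partition_cards) (simp add: petersen_verts_def)
  show "n \<le> 2" if "n \<in> {card P |P. strong_domatic_partition petersen_verts petersen_edges P}" for n
    using that strong_domatic_partition_petersen_card_le by auto
  \<comment> \<open>Distinctness is what gives the set of classes cardinality 2 rather than
    1.\<close>
  have "{1, 2, 3, 4, 5} \<noteq> {6, 7, 8, 9, 10 :: nat}"
    by (rule notI, drule equalityD1) simp
  then have "card {{1, 2, 3, 4, 5}, {6, 7, 8, 9, 10 :: nat}} = 2"
    by (rule card_2_iff[THEN iffD2, OF exI, OF exI, OF conjI, OF refl])
  then show "2 \<in> {card P |P. strong_domatic_partition petersen_verts petersen_edges P}"
    using strong_domatic_partition_petersen by force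
qed

end
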